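(* Let $\mathcal{T}$ be a triangulated category. A map of triangles of the form $(1_X,g,h)$, from $X\xrightarrow{u}Y\xrightarrow{v}Z\xrightarrow{w}\Sigma X$ to $X\xrightarrow{u'}Y'\xrightarrow{v'}Z'\xrightarrow{w'}\Sigma X$, is Verdier good if and only if it extends to an octahedron, i.e. it appears as the top two rows of an octahedron: there exist an exact triangle $Y\xrightarrow{g}Y'\xrightarrow{g'}Y''\xrightarrow{g''}\Sigma Y$ and maps $\beta\colon Z'\to Y''$, $\gamma\colon Y''\to\Sigma Z$ such that $(h,\beta,\gamma)$ is an octahedron for the composite $X\xrightarrow{u}Y\xrightarrow{g}Y'$ with respect to the triangles $(u,v,w)$, $(g,g',g'')$ and $(u'=gu,v',w')$.
   Context: $\mathcal{T}$ is a triangulated category with self-equivalence $\Sigma$. "Exact triangle" or "triangle" means distinguished triangle. A map of triangles $(f,g,h)$ from $X\xrightarrow{u}Y\xrightarrow{v}Z\xrightarrow{w}\Sigma X$ to $X'\xrightarrow{u'}Y'\xrightarrow{v'}Z'\xrightarrow{w'}\Sigma X'$ consists of $f\colon X\to X'$, $g\colon Y\to Y'$, $h\colon Z\to Z'$ with $gu=u'f$, $hv=v'g$, $(\Sigma f)w=w'h$. Octahedra: given composable maps $P\xrightarrow{a}Q\xrightarrow{b}R$ and exact triangles $P\xrightarrow{a}Q\xrightarrow{a'}C_a\xrightarrow{a''}\Sigma P$, $Q\xrightarrow{b}R\xrightarrow{b'}C_b\xrightarrow{b''}\Sigma Q$, $P\xrightarrow{ba}R\xrightarrow{c'}C\xrightarrow{c''}\Sigma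 P$, an octahedron for the composite $ba$ consists of maps $\alpha\colon C_a\to C$, $\beta\colon C\to C_b$, $\gamma\colon C_b\to\Sigma C_a$ such that $C_a\xrightarrow{\alpha}C\xrightarrow{\beta}C_b\xrightarrow{\gamma}\Sigma C_a$ is exact and $\alpha a'=c'b$, $c''\alpha=a''$, $\beta c'=b'$, $\gamma=(\Sigma a')b''$, $b''\beta=(\Sigma a)c''$. Verdier good: choose exact triangles $X\xrightarrow{f}X'\xrightarrow{f'}X''\xrightarrow{f''}\Sigma X$, $Y\xrightarrow{g}Y'\xrightarrow{g'}Y''\xrightarrow{g''}\Sigma Y$ and $X\xrightarrow{gu=u'f}Y'\xrightarrow{\tilde v}A\xrightarrow{\tilde w}\Sigma X$. The map $(f,g,h)$ is Verdier good if there exist an octahedron $(\alpha_1\colon Z\to A,\ \beta_1\colon A\to Y'',\ \gamma_1)$ for the composite $X\xrightarrow{u}Y\xrightarrow{g}Y'$ and an octahedron $(\alpha_2\colon X''\to A,\ \beta_2\colon A\to Z',\ \gamma_2)$ for the composite $X\xrightarrow{f}X'\xrightarrow{u'}Y'$ (both using the given and chosen triangles, in particular the same triangle on $gu=u'f$) such that $h=\beta_2\alpha_1$. This does not depend on the chosen triangles. *)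

theory Defs
  imports "HOL-Algebra.Group"
begin

section \<open>Categories\<close>

record ('o, 'm) category =
  Obj :: "'o set"
  Hom :: "'o \<Rightarrow> 'o \<Rightarrow> 'm set"
  ident :: "'o \<Rightarrow> 'm"
  compose :: "'m \<Rightarrow> 'm \<Rightarrow> 'm" (infixr \<open>\<cdot>\<index>\<close> 70)

text \<open>
  Composition is written in the usual order: \<open>g \<cdot> f\<close> is \<open>f\<close> followed by \<open>g\<close>.
  By \<open>Hom_objects\<close> and \<open>Hom_disjoint\<close> every arrow has a unique source and target,
  which are objects; membership in a \<open>Hom\<close> set therefore carries the typing information.
\<close>

locale category =
  fixes C :: "('o, 'm, 'e) category_scheme" (structure)
  assumes Hom_objects: "f \<in> Hom C X Y \<Longrightarrow> X \<in> Obj C \<and> Y \<in> Obj C"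
    and Hom_disjoint: "f \<in> Hom C X Y \<Longrightarrow> f \<in> Hom C X' Y' \<Longrightarrow> X = X' \<and> Y = Y'"
    and ident_in: "X \<in> Obj C \<Longrightarrow> ident C X \<in> Hom C X X"
    and compose_in: "f \<in> Hom C X Y \<Longrightarrow> g \<in> Hom C Y Z \<Longrightarrow> g \<cdot> f \<in> Hom C X Z"
    and compose_ident: "f \<in> Hom C X Y \<Longrightarrow> f \<cdot> ident C X = f"
    and ident_compose: "f \<in> Hom C X Y \<Longrightarrow> ident C Y \<cdot> f = f"
    and compose_assoc:
      "f \<in> Hom C W X \<Longrightarrow> g \<in> Hom C X Y \<Longrightarrow> h \<in> Hom C Y Z \<Longrightarrow>
        (h \<cdot> g) \<cdot> f = h \<cdot> (g \<cdot> f)"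

definition is_iso :: "('o, 'm, 'e) category_scheme \<Rightarrow> 'o \<Rightarrow> 'o \<Rightarrow> 'm \<Rightarrow> bool" where
  "is_iso C X Y f \<longleftrightarrow> f \<in> Hom C X Y \<and>
    (\<exists>g \<in> Hom C Y X. g \<cdot>\<^bsub>C\<^esub> f = ident C X \<and> f \<cdot>\<^bsub>C\<^esub> g = ident C Y)"

definition zero_object :: "('o, 'm, 'e) category_scheme \<Rightarrow> 'o \<Rightarrow> bool" where
  "zero_object C N \<longleftrightarrow> N \<in> Obj C \<and>
    (\<forall>X \<in> Obj C. (\<exists>!f. f \<in> Hom C X N) \<and> (\<exists>!f. f \<in> Hom C N X))"

definition is_functor ::
  "('o, 'm, 'e) category_scheme \<Rightarrow> ('p, 'n, 'f) category_scheme \<Rightarrow>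
    ('o \<Rightarrow> 'p) \<Rightarrow> ('m \<Rightarrow> 'n) \<Rightarrow> bool" where
  "is_functor C D Fo Fm \<longleftrightarrow>
    (\<forall>X \<in> Obj C. Fo X \<in> Obj D) \<and>
    (\<forall>X Y. \<forall>f \<in> Hom C X Y. Fm f \<in> Hom D (Fo X) (Fo Y)) \<and>
    (\<forall>X \<in> Obj C. Fm (ident C X) = ident D (Fo X)) \<and>
    (\<forall>X Y Z. \<forall>f \<in> Hom C X Y. \<forall>g \<in> Hom C Y Z.
      Fm (g \<cdot>\<^bsub>C\<^esub> f) = Fm g \<cdot>\<^bsub>D\<^esub> Fm f)"

definition naturally_isomorphic ::
  "('o, 'm, 'e) category_scheme \<Rightarrow> ('p, 'n, 'f) category_scheme \<Rightarrow>
    ('o \<Rightarrow> 'p) \<Rightarrow> ('m \<Rightarrow> 'n) \<Rightarrow> ('o \<Rightarrow> 'p) \<Rightarrow> ('m \<Rightarrow> 'n) \<Rightarrow> bool" where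
  "naturally_isomorphic C D Fo Fm Go Gm \<longleftrightarrow>
    (\<exists>\<eta>. (\<forall>X \<in> Obj C. is_iso D (Fo X) (Go X) (\<eta> X)) \<and>
         (\<forall>X Y. \<forall>f \<in> Hom C X Y. Gm f \<cdot>\<^bsub>D\<^esub> \<eta> X = \<eta> Y \<cdot>\<^bsub>D\<^esub> Fm f))"

definition is_equivalence ::
  "('o, 'm, 'e) category_scheme \<Rightarrow> ('p, 'n, 'f) category_scheme \<Rightarrow>
    ('o \<Rightarrow> 'p) \<Rightarrow> ('m \<Rightarrow> 'n) \<Rightarrow> bool" where
  "is_equivalence C D Fo Fm \<longleftrightarrow> is_functor C D Fo Fm \<and>
    (\<exists>Go Gm. is_functor D C Go Gm \<and>
      naturally_isomorphic C C (Go \<circ> Fo) (Gm \<circ> Fm) id id \<and>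
      naturally_isomorphic D D (Fo \<circ> Go) (Fm \<circ> Gm) id id)"


section \<open>Additive categories\<close>

record ('o, 'm) preadditive_category = "('o, 'm) category" +
  add_map :: "'m \<Rightarrow> 'm \<Rightarrow> 'm"
  zero_map :: "'o \<Rightarrow> 'o \<Rightarrow> 'm"

text \<open>The additive group of maps from \<open>X\<close> to \<open>Y\<close>, in multiplicative notation.\<close>

definition hom_group ::
  "('o, 'm, 'e) preadditive_category_scheme \<Rightarrow> 'o \<Rightarrow> 'o \<Rightarrow> 'm monoid" where
  "hom_group C X Y = \<lparr>carrier = Hom C X Y, mult = add_map C, one = zero_map C X Y\<rparr>"

definition neg_map ::
  "('o, 'm, 'e) preadditive_category_scheme \<Rightarrow> 'o \<Rightarrow> 'o \<Rightarrow> 'm \<Rightarrow> 'm" where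
  "neg_map C X Y f = inv\<^bsub>hom_group C X Y\<^esub> f"

locale preadditive_category = category C
  for C :: "('o, 'm, 'e) preadditive_category_scheme" (structure) +
  assumes hom_comm_group:
      "X \<in> Obj C \<Longrightarrow> Y \<in> Obj C \<Longrightarrow> comm_group (hom_group C X Y)"
    and compose_add_left:
      "f \<in> Hom C X Y \<Longrightarrow> g \<in> Hom C Y Z \<Longrightarrow> g' \<in> Hom C Y Z \<Longrightarrow>
        add_map C g g' \<cdot> f = add_map C (g \<cdot> f) (g' \<cdot> f)"
    and compose_add_right:
      "f \<in> Hom C X Y \<Longrightarrow> f' \<in> Hom C X Y \<Longrightarrow> g \<in> Hom C Y Z \<Longrightarrow>
        g \<cdot> add_map C f f' = add_map C (g \<cdot> f) (g \<cdot> f')"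

definition is_biproduct ::
  "('o, 'm, 'e) preadditive_category_scheme \<Rightarrow> 'o \<Rightarrow> 'o \<Rightarrow> 'o \<Rightarrow>
    'm \<Rightarrow> 'm \<Rightarrow> 'm \<Rightarrow> 'm \<Rightarrow> bool" where
  "is_biproduct C X Y B i j p q \<longleftrightarrow>
    i \<in> Hom C X B \<and> j \<in> Hom C Y B \<and> p \<in> Hom C B X \<and> q \<in> Hom C B Y \<and>
    p \<cdot>\<^bsub>C\<^esub> i = ident C X \<and> q \<cdot>\<^bsub>C\<^esub> j = ident C Y \<and>
    p \<cdot>\<^bsub>C\<^esub> j = zero_map C Y X \<and> q \<cdot>\<^bsub>C\<^esub> i = zero_map C X Y \<and>
    add_map C (i \<cdot>\<^bsub>C\<^esub> p) (j \<cdot>\<^bsub>C\<^esub> q) = ident C B"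

locale additive_category = preadditive_category C
  for C :: "('o, 'm, 'e) preadditive_category_scheme" (structure) +
  assumes zero_object_exists: "\<exists>N. zero_object C N"
    and biproduct_exists:
      "X \<in> Obj C \<Longrightarrow> Y \<in> Obj C \<Longrightarrow> \<exists>B i j p q. is_biproduct C X Y B i j p q"


section \<open>Triangulated categories\<close>

text \<open>\<open>Tri X Y Z u v w\<close> stands for \<open>X \<rightarrow> Y \<rightarrow> Z \<rightarrow> \<Sigma>X\<close> with maps \<open>u\<close>, \<open>v\<close>, \<open>w\<close>.\<close>

datatype ('o, 'm) triangle = Tri 'o 'o 'o 'm 'm 'm

record ('o, 'm) triangulated_category = "('o, 'm) preadditive_category" +
  susp_obj :: "'o \<Rightarrow> 'o"
  susp_map :: "'m \<Rightarrow> 'm"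
  exact_triangles :: "('o, 'm) triangle set"

fun candidate_triangle ::
  "('o, 'm, 'e) triangulated_category_scheme \<Rightarrow> ('o, 'm) triangle \<Rightarrow> bool" where
  "candidate_triangle T (Tri X Y Z u v w) \<longleftrightarrow>
    u \<in> Hom T X Y \<and> v \<in> Hom T Y Z \<and> w \<in> Hom T Z (susp_obj T X)"

fun triangle_map ::
  "('o, 'm, 'e) triangulated_category_scheme \<Rightarrow> ('o, 'm) triangle \<Rightarrow> ('o, 'm) triangle \<Rightarrow>
    'm \<Rightarrow> 'm \<Rightarrow> 'm \<Rightarrow> bool" where
  "triangle_map T (Tri X Y Z u v w) (Tri X' Y' Z' u' v' w') f g h \<longleftrightarrow>
    f \<in> Hom T X X' \<and> g \<in> Hom T Y Y' \<and> h \<in> Hom T Z Z' \<and>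
    g \<cdot>\<^bsub>T\<^esub> u = u' \<cdot>\<^bsub>T\<^esub> f \<and>
    h \<cdot>\<^bsub>T\<^esub> v = v' \<cdot>\<^bsub>T\<^esub> g \<and>
    susp_map T f \<cdot>\<^bsub>T\<^esub> w = w' \<cdot>\<^bsub>T\<^esub> h"

fun triangle_iso ::
  "('o, 'm, 'e) triangulated_category_scheme \<Rightarrow> ('o, 'm) triangle \<Rightarrow> ('o, 'm) triangle \<Rightarrow>
    'm \<Rightarrow> 'm \<Rightarrow> 'm \<Rightarrow> bool" where
  "triangle_iso T (Tri X Y Z u v w) (Tri X' Y' Z' u' v' w') f g h \<longleftrightarrow>
    triangle_map T (Tri X Y Z u v w) (Tri X' Y' Z' u' v' w') f g h \<and>
    is_iso T X X' f \<and> is_iso T Y Y' g \<and> is_iso T Z Z' h"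

text \<open>
  \<open>octahedron T D\<^sub>a D\<^sub>b D\<^sub>c \<alpha> \<beta> \<gamma>\<close>: the three exact triangles are on \<open>a\<close>, on \<open>b\<close> and on
  their composite, and \<open>(\<alpha>, \<beta>, \<gamma>)\<close> is an octahedron for \<open>b \<cdot> a\<close> with respect to them.
  The types of \<open>\<alpha>\<close>, \<open>\<beta>\<close>, \<open>\<gamma>\<close> are implied by the exactness of the triangle they form,
  as exact triangles are candidate triangles.
\<close>

fun octahedron ::
  "('o, 'm, 'e) triangulated_category_scheme \<Rightarrow>
    ('o, 'm) triangle \<Rightarrow> ('o, 'm) triangle \<Rightarrow> ('o, 'm) triangle \<Rightarrow>
    'm \<Rightarrow> 'm \<Rightarrow> 'm \<Rightarrow> bool" where
  "octahedron T (Tri P Q Ca a a' a'') (Tri Q\<^sub>1 R Cb b b' b'') (Tri P\<^sub>1 R\<^sub>1 Cc c c' c'') \<alpha> \<beta> \<gamma> \<longleftrightarrow>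
    P\<^sub>1 = P \<and> Q\<^sub>1 = Q \<and> R\<^sub>1 = R \<and> c = b \<cdot>\<^bsub>T\<^esub> a \<and>
    Tri P Q Ca a a' a'' \<in> exact_triangles T \<and>
    Tri Q R Cb b b' b'' \<in> exact_triangles T \<and>
    Tri P R Cc c c' c'' \<in> exact_triangles T \<and>
    Tri Ca Cc Cb \<alpha> \<beta> \<gamma> \<in> exact_triangles T \<and>
    \<alpha> \<cdot>\<^bsub>T\<^esub> a' = c' \<cdot>\<^bsub>T\<^esub> b \<and>
    c'' \<cdot>\<^bsub>T\<^esub> \<alpha> = a'' \<and>
    \<beta> \<cdot>\<^bsub>T\<^esub> c' = b' \<and>
    \<gamma> = susp_map T a' \<cdot>\<^bsub>T\<^esub> b'' \<and>
    b'' \<cdot>\<^bsub>T\<^esub> \<beta> = susp_map T a \<cdot>\<^bsub>T\<^esub> c''"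

locale triangulated_category = additive_category T
  for T :: "('o, 'm, 'e) triangulated_category_scheme" (structure) +
  assumes susp_equivalence: "is_equivalence T T (susp_obj T) (susp_map T)"
    and susp_additive:
      "f \<in> Hom T X Y \<Longrightarrow> g \<in> Hom T X Y \<Longrightarrow>
        susp_map T (add_map T f g) = add_map T (susp_map T f) (susp_map T g)"
    and exact_candidate: "D \<in> exact_triangles T \<Longrightarrow> candidate_triangle T D"
    and TR1_iso_closed:
      "D \<in> exact_triangles T \<Longrightarrow> candidate_triangle T D' \<Longrightarrow> triangle_iso T D D' f g h \<Longrightarrow>
        D' \<in> exact_triangles T"
    and TR1_ident:
      "X \<in> Obj T \<Longrightarrow> zero_object T N \<Longrightarrow>
        Tri X X N (ident T X) (zero_map T X N) (zero_map T N (susp_obj T X))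
          \<in> exact_triangles T"
    and TR1_extend:
      "u \<in> Hom T X Y \<Longrightarrow> \<exists>Z v w. Tri X Y Z u v w \<in> exact_triangles T"
    and TR2_rotate:
      "candidate_triangle T (Tri X Y Z u v w) \<Longrightarrow>
        Tri X Y Z u v w \<in> exact_triangles T \<longleftrightarrow>
        Tri Y Z (susp_obj T X) v w (neg_map T (susp_obj T X) (susp_obj T Y) (susp_map T u))
          \<in> exact_triangles T"
    and TR3_fill:
      "Tri X Y Z u v w \<in> exact_triangles T \<Longrightarrow> Tri X' Y' Z' u' v' w' \<in> exact_triangles T \<Longrightarrow>
        f \<in> Hom T X X' \<Longrightarrow> g \<in> Hom T Y Y' \<Longrightarrow> g \<cdot> u = u' \<cdot> f \<Longrightarrow>
        \<exists>h. triangle_map T (Tri X Y Z u v w) (Tri X' Y' Z' u' v' w') f g h"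
    and TR4_octahedron:
      "Tri P Q Ca a a' a'' \<in> exact_triangles T \<Longrightarrow>
        Tri Q R Cb b b' b'' \<in> exact_triangles T \<Longrightarrow>
        Tri P R Cc (b \<cdot> a) c' c'' \<in> exact_triangles T \<Longrightarrow>
        \<exists>\<alpha> \<beta> \<gamma>. octahedron T (Tri P Q Ca a a' a'') (Tri Q R Cb b b' b'')
          (Tri P R Cc (b \<cdot> a) c' c'') \<alpha> \<beta> \<gamma>"

text \<open>
  The auxiliary exact triangles on \<open>f\<close>, on \<open>g\<close> and on \<open>g \<cdot> u = u' \<cdot> f\<close> are existentially
  quantified. They always exist, and whether suitable octahedra exist does not depend on
  their choice. Both octahedra use the same triangle \<open>(g \<cdot> u, v\<^sub>A, w\<^sub>A)\<close> on the diagonal.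
\<close>

fun verdier_good ::
  "('o, 'm, 'e) triangulated_category_scheme \<Rightarrow> ('o, 'm) triangle \<Rightarrow> ('o, 'm) triangle \<Rightarrow>
    'm \<Rightarrow> 'm \<Rightarrow> 'm \<Rightarrow> bool" where
  "verdier_good T (Tri X Y Z u v w) (Tri X' Y' Z' u' v' w') f g h \<longleftrightarrow>
    triangle_map T (Tri X Y Z u v w) (Tri X' Y' Z' u' v' w') f g h \<and>
    (\<exists>X'' f' f'' Y'' g' g'' A v\<^sub>A w\<^sub>A.
      Tri X X' X'' f f' f'' \<in> exact_triangles T \<and>
      Tri Y Y' Y'' g g' g'' \<in> exact_triangles T \<and>
      Tri X Y' A (g \<cdot>\<^bsub>T\<^esub> u) v\<^sub>A w\<^sub>A \<in> exact_triangles T \<and>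
      (\<exists>\<alpha>\<^sub>1 \<beta>\<^sub>1 \<gamma>\<^sub>1 \<alpha>\<^sub>2 \<beta>\<^sub>2 \<gamma>\<^sub>2.
        octahedron T (Tri X Y Z u v w) (Tri Y Y' Y'' g g' g'')
          (Tri X Y' A (g \<cdot>\<^bsub>T\<^esub> u) v\<^sub>A w\<^sub>A) \<alpha>\<^sub>1 \<beta>\<^sub>1 \<gamma>\<^sub>1 \<and>
        octahedron T (Tri X X' X'' f f' f'') (Tri X' Y' Z' u' v' w')
          (Tri X Y' A (g \<cdot>\<^bsub>T\<^esub> u) v\<^sub>A w\<^sub>A) \<alpha>\<^sub>2 \<beta>\<^sub>2 \<gamma>\<^sub>2 \<and>
        h = \<beta>\<^sub>2 \<cdot>\<^bsub>T\<^esub> \<alpha>\<^sub>1))"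

end

theory Submission
  imports Defs
begin

text \<open>
  In the second octahedron of a Verdier good map \<open>(1\<^sub>X, g, h)\<close> the cone of \<open>1\<^sub>X\<close> is zero,
  so \<open>\<beta>\<^sub>2 : A \<rightarrow> Z'\<close> is an isomorphism compatible with the two triangles on \<open>g u = u'\<close>;
  transporting the first octahedron along it replaces \<open>A\<close> by \<open>Z'\<close> and \<open>\<alpha>\<^sub>1\<close> by
  \<open>\<beta>\<^sub>2 \<alpha>\<^sub>1 = h\<close>. Conversely, if \<open>(h, \<beta>, \<gamma>)\<close> is an octahedron, choose \<open>A = Z'\<close> and
  take \<open>(0, 1, 0)\<close> as the second octahedron.
\<close>

section \<open>Zero maps, signs and zero objects in preadditive categories\<close>

lemma (in category) is_iso_ident: "X \<in> Obj C \<Longrightarrow> is_iso C X X (ident C X)"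
  unfolding is_iso_def using ident_in compose_ident by blast

context preadditive_category
begin

lemma hom_group_group: "X \<in> Obj C \<Longrightarrow> Y \<in> Obj C \<Longrightarrow> group (hom_group C X Y)"
  using hom_comm_group comm_group_def by blast

lemma zero_map_in: "X \<in> Obj C \<Longrightarrow> Y \<in> Obj C \<Longrightarrow> zero_map C X Y \<in> Hom C X Y"
  using group.is_monoid[OF hom_group_group, THEN monoid.one_closed]
  by (simp add: hom_group_def)

lemma add_map_in:
  assumes "f \<in> Hom C X Y" "g \<in> Hom C X Y"
  shows "add_map C f g \<in> Hom C X Y"
proof -
  interpret group "hom_group C X Y"
    using hom_group_group Hom_objects assms by blast
  show ?thesis
    using m_closed[of f g] assms by (simp add: hom_group_def)
qed

lemma neg_map_in:
  assumes "f \<in> Hom C X Y"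
  shows "neg_map C X Y f \<in> Hom C X Y"
proof -
  interpret group "hom_group C X Y"
    using hom_group_group Hom_objects assms by blast
  show ?thesis
    using inv_closed[of f] assms by (simp add: neg_map_def hom_group_def)
qed

lemma add_neg_map:
  assumes "f \<in> Hom C X Y"
  shows "add_map C f (neg_map C X Y f) = zero_map C X Y"
proof -
  interpret group "hom_group C X Y"
    using hom_group_group Hom_objects assms by blast
  show ?thesis
    using r_inv[of f] assms by (simp add: neg_map_def hom_group_def)
qed

lemma add_zero_map:
  assumes "f \<in> Hom C X Y"
  shows "add_map C f (zero_map C X Y) = f"
proof -
  interpret group "hom_group C X Y"
    using hom_group_group Hom_objects assms by blast
  show ?thesis
    using r_one[of f] assms by (simp add: hom_group_def)
qed

lemma add_map_right_cancel:
  assumes "f \<in> Hom C X Y" "g \<in> Hom C X Y" "h \<in> Hom C X Y" "add_map C g f = add_map C h f"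
  shows "g = h"
proof -
  interpret group "hom_group C X Y"
    using hom_group_group Hom_objects assms by blast
  show ?thesis
    using right_cancel[of f g h] assms by (simp add: hom_group_def)
qed

text \<open>Used to show that composition and suspension preserve zero maps: by additivity the image
  x of a zero map satisfies x + x = x.\<close>

lemma add_map_idempotent:
  assumes "f \<in> Hom C X Y" "add_map C f f = f"
  shows "f = zero_map C X Y"
proof -
  interpret group "hom_group C X Y"
    using hom_group_group Hom_objects assms by blast
  show ?thesis
    using l_cancel_one[of f f] assms by (simp add: hom_group_def)
qed

lemma zero_compose:
  assumes "f \<in> Hom C X Y" "Z \<in> Obj C"
  shows "zero_map C Y Z \<cdot> f = zero_map C X Z"
proof (rule add_map_idempotent)
  have z: "zero_map C Y Z \<in> Hom C Y Z"
    using zero_map_in Hom_objects assms by blast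
  show "zero_map C Y Z \<cdot> f \<in> Hom C X Z"
    using compose_in assms(1) z .
  show "add_map C (zero_map C Y Z \<cdot> f) (zero_map C Y Z \<cdot> f) = zero_map C Y Z \<cdot> f"
    using compose_add_left[OF assms(1) z z] add_zero_map[OF z] by simp
qed

lemma compose_zero:
  assumes "f \<in> Hom C Y Z" "X \<in> Obj C"
  shows "f \<cdot> zero_map C X Y = zero_map C X Z"
proof (rule add_map_idempotent)
  have z: "zero_map C X Y \<in> Hom C X Y"
    using zero_map_in Hom_objects assms by blast
  show "f \<cdot> zero_map C X Y \<in> Hom C X Z"
    using compose_in z assms(1) .
  show "add_map C (f \<cdot> zero_map C X Y) (f \<cdot> zero_map C X Y) = f \<cdot> zero_map C X Y"
    using compose_add_right[OF z z assms(1)] add_zero_map[OF z] by simp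
qed

text \<open>Removes the sign that rotating a triangle on an identity produces: 0 = (1 + (-1)) f = f
  + (-1) f = f + 0.\<close>

lemma neg_ident_compose_eq_zero:
  assumes f: "f \<in> Hom C X Y" and zero: "neg_map C Y Y (ident C Y) \<cdot> f = zero_map C X Y"
  shows "f = zero_map C X Y"
proof -
  have Y: "Y \<in> Obj C"
    using Hom_objects f by blast
  let ?n = "neg_map C Y Y (ident C Y)"
  have "add_map C (ident C Y) ?n \<cdot> f = add_map C f (zero_map C X Y)"
    using compose_add_left[OF f ident_in[OF Y] neg_map_in[OF ident_in[OF Y]]]
      ident_compose[OF f] zero by simp
  then show ?thesis
    using add_neg_map[OF ident_in[OF Y]] zero_compose[OF f Y] add_zero_map[OF f] by simp
qed

text \<open>Turns a universal property into an equation, which additive functors preserve. If 1 = 0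
  on \<open>X\<close>, every map into or out of \<open>X\<close> is zero, being its own composite
  with 1.\<close>

lemma zero_object_iff:
  assumes "X \<in> Obj C"
  shows "zero_object C X \<longleftrightarrow> ident C X = zero_map C X X"
proof
  assume "zero_object C X"
  then show "ident C X = zero_map C X X"
    using assms ident_in zero_map_in unfolding zero_object_def by metis
next
  assume id: "ident C X = zero_map C X X"
  have "f = zero_map C Y X" if "f \<in> Hom C Y X" for f Y
    using ident_compose[OF that] zero_compose[OF that assms] id by simp
  moreover have "f = zero_map C X Y" if "f \<in> Hom C X Y" for f Y
    using compose_ident[OF that] compose_zero[OF that assms] id by simp
  ultimately show "zero_object C X"
    unfolding zero_object_def using assms zero_map_in by metis
qed

lemma to_zero_object: "zero_object C N \<Longrightarrow> f \<in> Hom C X N \<Longrightarrow> f = zero_map C X N"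
  using Hom_objects zero_map_in unfolding zero_object_def by metis

lemma from_zero_object: "zero_object C N \<Longrightarrow> f \<in> Hom C N X \<Longrightarrow> f = zero_map C N X"
  using Hom_objects zero_map_in unfolding zero_object_def by metis

end

section \<open>Suspension, weak cokernels and cones involving zero objects\<close>

context triangulated_category
begin

lemma susp_functor: "is_functor T T (susp_obj T) (susp_map T)"
  using susp_equivalence is_equivalence_def by blast

lemma susp_obj_in: "X \<in> Obj T \<Longrightarrow> susp_obj T X \<in> Obj T"
  using susp_functor by (simp add: is_functor_def)

lemma susp_map_in: "f \<in> Hom T X Y \<Longrightarrow> susp_map T f \<in> Hom T (susp_obj T X) (susp_obj T Y)"
  using susp_functor by (simp add: is_functor_def)

lemma susp_ident: "X \<in> Obj T \<Longrightarrow> susp_map T (ident T X) = ident T (susp_obj T X)"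
  using susp_functor by (simp add: is_functor_def)

lemma susp_zero_map:
  assumes "X \<in> Obj T" "Y \<in> Obj T"
  shows "susp_map T (zero_map T X Y) = zero_map T (susp_obj T X) (susp_obj T Y)"
proof (rule add_map_idempotent)
  have z: "zero_map T X Y \<in> Hom T X Y"
    using zero_map_in assms .
  show "susp_map T (zero_map T X Y) \<in> Hom T (susp_obj T X) (susp_obj T Y)"
    using susp_map_in z .
  show "add_map T (susp_map T (zero_map T X Y)) (susp_map T (zero_map T X Y))
      = susp_map T (zero_map T X Y)"
    using susp_additive[OF z z] add_zero_map[OF z] by simp
qed

lemma susp_zero_object:
  assumes "zero_object T N"
  shows "zero_object T (susp_obj T N)"
proof -
  have N: "N \<in> Obj T"
    using assms by (simp add: zero_object_def)
  then show ?thesis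
    using assms susp_ident susp_zero_map susp_obj_in zero_object_iff by metis
qed

lemma exact_maps:
  assumes "Tri X Y Z u v w \<in> exact_triangles T"
  shows "u \<in> Hom T X Y" "v \<in> Hom T Y Z" "w \<in> Hom T Z (susp_obj T X)"
  using exact_candidate[OF assms] by simp_all

lemma exact_rotate:
  assumes "Tri X Y Z u v w \<in> exact_triangles T"
  shows "Tri Y Z (susp_obj T X) v w (neg_map T (susp_obj T X) (susp_obj T Y) (susp_map T u))
    \<in> exact_triangles T"
  using TR2_rotate exact_candidate assms by blast

text \<open>One rotation turns this into the triangle that \<open>TR1_ident\<close> gives for
  \<open>W\<close> and the zero object \<Sigma>N; the sign does no harm, since the rotated map
  starts at a zero object.\<close>

lemma exact_from_zero_object:
  assumes N: "zero_object T N" and W: "W \<in> Obj T"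
  shows "Tri N W W (zero_map T N W) (ident T W) (zero_map T W (susp_obj T N))
    \<in> exact_triangles T"
proof -
  have N': "N \<in> Obj T"
    using N by (simp add: zero_object_def)
  note [simp] = N' W zero_map_in ident_in susp_obj_in susp_map_in neg_map_in
  have "neg_map T (susp_obj T N) (susp_obj T W) (susp_map T (zero_map T N W))
      = zero_map T (susp_obj T N) (susp_obj T W)"
    by (rule from_zero_object[OF susp_zero_object[OF N]]) simp
  then show ?thesis
    using TR1_ident[OF W susp_zero_object[OF N]] by (subst TR2_rotate) simp_all
qed

text \<open>\<open>TR3_fill\<close> extends the square with sides \<open>ident T X\<close> and
  \<open>u\<close> to a map from the triangle on \<open>ident T X\<close>; hence
  \<open>v \<cdot> u\<close> factors through a zero object.\<close>

lemma exact_compose_zero: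
  assumes D: "Tri X Y Z u v w \<in> exact_triangles T"
  shows "v \<cdot> u = zero_map T X Z"
proof -
  note maps = exact_maps[OF D]
  obtain N where N: "zero_object T N"
    using zero_object_exists by blast
  have X: "X \<in> Obj T"
    using Hom_objects maps(1) by blast
  obtain h where h: "h \<in> Hom T N Z" "h \<cdot> zero_map T X N = v \<cdot> u"
    using TR3_fill[OF TR1_ident[OF X N] D ident_in[OF X] maps(1)] by auto
  then show ?thesis
    using compose_zero X by metis
qed

text \<open>Since \<open>k \<cdot> u\<close> vanishes, the zero map from \<open>X\<close> to
  \<open>N\<close> and \<open>k\<close> form a square from \<open>D\<close> to the triangle N -> W =
  W -> \<Sigma>N; the third component of its fill-in is the required factorization.\<close>

lemma weak_cokernel:
  assumes D: "Tri X Y Z u v w \<in> exact_triangles T"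
    and k: "k \<in> Hom T Y W" and ku: "k \<cdot> u = zero_map T X W"
  obtains h where "h \<in> Hom T Z W" "h \<cdot> v = k"
proof -
  note maps = exact_maps[OF D]
  obtain N where N: "zero_object T N"
    using zero_object_exists by blast
  have objs: "X \<in> Obj T" "W \<in> Obj T" "N \<in> Obj T"
    using Hom_objects maps(1) k N by (blast, blast, simp add: zero_object_def)
  have "k \<cdot> u = zero_map T N W \<cdot> zero_map T X N"
    using ku compose_zero zero_map_in objs by metis
  then obtain h where "h \<in> Hom T Z W" "h \<cdot> v = ident T W \<cdot> k"
    using TR3_fill[OF D exact_from_zero_object[OF N objs(2)] zero_map_in[OF objs(1,3)] k]
    by auto
  then show thesis
    using that ident_compose[OF k] by simp
qed

lemma cone_ident_zero_object:
  assumes D: "Tri X X Z (ident T X) v w \<in> exact_triangles T"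
  shows "zero_object T Z"
proof -
  note maps = exact_maps[OF D]
  have objs: "X \<in> Obj T" "Z \<in> Obj T" "susp_obj T X \<in> Obj T"
    using Hom_objects maps by blast+
  have v: "v = zero_map T X Z"
    using exact_compose_zero[OF D] compose_ident[OF maps(2)] by simp
  \<comment> \<open>After two rotations \<open>w\<close> is followed by -\<Sigma>1, so (-1) w =
    0.\<close>
  have w: "w = zero_map T Z (susp_obj T X)"
    using exact_compose_zero[OF exact_rotate[OF exact_rotate[OF D]]]
      neg_ident_compose_eq_zero[OF maps(3)] susp_ident[OF objs(1)] by simp
  \<comment> \<open>As \<open>v\<close> vanishes, the identity of \<open>Z\<close> factors through
    \<open>w\<close>, which vanishes as well.\<close>
  have "ident T Z \<cdot> v = zero_map T X Z"
    using ident_compose[OF maps(2)] v by simp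
  then obtain h where "h \<in> Hom T (susp_obj T X) Z" "h \<cdot> w = ident T Z"
    using weak_cokernel[OF exact_rotate[OF D] ident_in[OF objs(2)]] by blast
  then show ?thesis
    using w compose_zero objs zero_object_iff by metis
qed

text \<open>As \<open>u\<close> is zero, the identity of \<open>Y\<close> factors through
  \<open>v\<close>, which gives a left inverse \<open>h\<close>. It is also a right inverse: vh - 1
  kills \<open>v\<close>, so it factors through \<open>w\<close>, a map into the zero object
  \<Sigma>X.\<close>

lemma zero_object_cone_iso:
  assumes D: "Tri X Y Z u v w \<in> exact_triangles T" and X: "zero_object T X"
  shows "is_iso T Y Z v"
proof -
  note maps = exact_maps[OF D]
  have objs: "X \<in> Obj T" "Y \<in> Obj T" "Z \<in> Obj T"
    using Hom_objects maps by blast+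
  have "ident T Y \<cdot> u = zero_map T X Y"
    using ident_compose[OF maps(1)] from_zero_object[OF X maps(1)] by simp
  then obtain h where h: "h \<in> Hom T Z Y" "h \<cdot> v = ident T Y"
    using weak_cokernel[OF D ident_in[OF objs(2)]] by blast
  have vh: "v \<cdot> h \<in> Hom T Z Z"
    using compose_in h(1) maps(2) .
  let ?n = "neg_map T Z Z (ident T Z)"
  \<comment> \<open>The difference vh - 1, to be shown equal to 1 - 1 and thus zero.\<close>
  let ?k = "add_map T (v \<cdot> h) ?n"
  have id: "ident T Z \<in> Hom T Z Z" and n: "?n \<in> Hom T Z Z"
    using ident_in neg_map_in objs(3) by blast+
  have "v \<cdot> h \<cdot> v = v"
    using h(2) compose_ident[OF maps(2)] by simp
  then have "(v \<cdot> h) \<cdot> v = ident T Z \<cdot> v"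
    using compose_assoc[OF maps(2) h(1) maps(2)] ident_compose[OF maps(2)] by simp
  then have "?k \<cdot> v = add_map T (ident T Z) ?n \<cdot> v"
    using compose_add_left[OF maps(2) vh n] compose_add_left[OF maps(2) id n] by simp
  then have "?k \<cdot> v = zero_map T Y Z"
    using add_neg_map[OF id] zero_compose[OF maps(2) objs(3)] by simp
  then obtain l where l: "l \<in> Hom T (susp_obj T X) Z" "l \<cdot> w = ?k"
    using weak_cokernel[OF exact_rotate[OF D] add_map_in[OF vh n]] by blast
  have "w = zero_map T Z (susp_obj T X)"
    using to_zero_object[OF susp_zero_object[OF X] maps(3)] .
  then have "?k = add_map T (ident T Z) ?n"
    using l compose_zero[OF l(1) objs(3)] add_neg_map[OF id] by simp
  then have "v \<cdot> h = ident T Z"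
    using add_map_right_cancel[OF n vh id] by simp
  then show ?thesis
    unfolding is_iso_def using maps(2) h by blast
qed

end

section \<open>Verdier good maps with identity first component\<close>

theorem proposition6p16:
  fixes T :: "('o, 'm, 'e) triangulated_category_scheme"
    and X Y Z Y' Z' :: 'o
    and u v w u' v' w' g h :: 'm
  assumes "triangulated_category T"
    and "Tri X Y Z u v w \<in> exact_triangles T"
    and "Tri X Y' Z' u' v' w' \<in> exact_triangles T"
    and "triangle_map T (Tri X Y Z u v w) (Tri X Y' Z' u' v' w') (ident T X) g h"
  shows "verdier_good T (Tri X Y Z u v w) (Tri X Y' Z' u' v' w') (ident T X) g h \<longleftrightarrow>
    (\<exists>Y'' g' g'' \<beta> \<gamma>.
      Tri Y Y' Y'' g g' g'' \<in> exact_triangles T \<and>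
      octahedron T (Tri X Y Z u v w) (Tri Y Y' Y'' g g' g'') (Tri X Y' Z' u' v' w') h \<beta> \<gamma>)"
proof -
  interpret triangulated_category T
    by fact
  have u': "u' \<in> Hom T X Y'" and v': "v' \<in> Hom T Y' Z'" and w': "w' \<in> Hom T Z' (susp_obj T X)"
    using exact_maps[OF assms(3)] .
  have objs: "X \<in> Obj T" "Y' \<in> Obj T" "Z' \<in> Obj T" "susp_obj T X \<in> Obj T"
    using Hom_objects u' v' w' by blast+
  have gu: "g \<cdot>\<^bsub>T\<^esub> u = u'"
    using assms(4) compose_ident[OF u'] by simp
  show ?thesis
  proof
    assume "verdier_good T (Tri X Y Z u v w) (Tri X Y' Z' u' v' w') (ident T X) g h"
    then obtain X'' f' f'' Y'' g' g'' A v\<^sub>A w\<^sub>A \<alpha>\<^sub>1 \<beta>\<^sub>1 \<gamma>\<^sub>1 \<alpha>\<^sub>2 \<beta>\<^sub>2 \<gamma>\<^sub>2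
      where F: "Tri X X X'' (ident T X) f' f'' \<in> exact_triangles T"
        and G: "Tri Y Y' Y'' g g' g'' \<in> exact_triangles T"
        and A: "Tri X Y' A (g \<cdot>\<^bsub>T\<^esub> u) v\<^sub>A w\<^sub>A \<in> exact_triangles T"
        and oct1: "octahedron T (Tri X Y Z u v w) (Tri Y Y' Y'' g g' g'')
          (Tri X Y' A (g \<cdot>\<^bsub>T\<^esub> u) v\<^sub>A w\<^sub>A) \<alpha>\<^sub>1 \<beta>\<^sub>1 \<gamma>\<^sub>1"
        and oct2: "octahedron T (Tri X X X'' (ident T X) f' f'') (Tri X Y' Z' u' v' w')
          (Tri X Y' A (g \<cdot>\<^bsub>T\<^esub> u) v\<^sub>A w\<^sub>A) \<alpha>\<^sub>2 \<beta>\<^sub>2 \<gamma>\<^sub>2"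
        and h: "h = \<beta>\<^sub>2 \<cdot>\<^bsub>T\<^esub> \<alpha>\<^sub>1"
      by auto
    have D1: "Tri Z A Y'' \<alpha>\<^sub>1 \<beta>\<^sub>1 \<gamma>\<^sub>1 \<in> exact_triangles T"
      and D2: "Tri X'' A Z' \<alpha>\<^sub>2 \<beta>\<^sub>2 \<gamma>\<^sub>2 \<in> exact_triangles T"
      using oct1 oct2 unfolding octahedron.simps by blast+
    note maps1 = exact_maps[OF D1] and mapsA = exact_maps[OF A] and mapsG = exact_maps[OF G]
    have b2: "\<beta>\<^sub>2 \<in> Hom T A Z'"
      using exact_maps[OF D2] by simp
    have iso: "is_iso T A Z' \<beta>\<^sub>2"
      using zero_object_cone_iso[OF D2 cone_ident_zero_object[OF F]] .
    then obtain i where i: "i \<in> Hom T Z' A" "i \<cdot>\<^bsub>T\<^esub> \<beta>\<^sub>2 = ident T A" "\<beta>\<^sub>2 \<cdot>\<^bsub>T\<^esub> i = ident T Z'"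
      unfolding is_iso_def by blast
    \<comment> \<open>These are the octahedron equations \<beta>c' = b' and b''\<beta> =
      (\<Sigma>a)c'' for a = 1.\<close>
    have b2v: "\<beta>\<^sub>2 \<cdot>\<^bsub>T\<^esub> v\<^sub>A = v'" and wb2: "w' \<cdot>\<^bsub>T\<^esub> \<beta>\<^sub>2 = w\<^sub>A"
      using oct2 susp_ident[OF objs(1)] ident_compose[OF mapsA(3)]
      unfolding octahedron.simps by simp_all
    have iv: "i \<cdot>\<^bsub>T\<^esub> v' = v\<^sub>A"
      using compose_assoc[OF mapsA(2) b2 i(1)] i(2) b2v ident_compose[OF mapsA(2)] by simp
    have wi: "w\<^sub>A \<cdot>\<^bsub>T\<^esub> i = w'"
      using compose_assoc[OF i(1) b2 w'] i(3) wb2 compose_ident[OF w'] by simp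
    have objs1: "Z \<in> Obj T" "Y'' \<in> Obj T" "susp_obj T Z \<in> Obj T"
      using Hom_objects maps1 by blast+
    \<comment> \<open>The map out of \<open>A\<close> is moved to \<open>Z'\<close> along the
      inverse \<open>i\<close>; the third map of the triangle stays unchanged.\<close>
    let ?\<beta> = "\<beta>\<^sub>1 \<cdot>\<^bsub>T\<^esub> i"
    have b: "?\<beta> \<in> Hom T Z' Y''"
      using compose_in[OF i(1) maps1(2)] .
    have hZ: "h \<in> Hom T Z Z'"
      using compose_in[OF maps1(1) b2] h by simp
    have "?\<beta> \<cdot>\<^bsub>T\<^esub> \<beta>\<^sub>2 = \<beta>\<^sub>1"
      using compose_assoc[OF b2 i(1) maps1(2)] i(2) compose_ident[OF maps1(2)] by simp
    then have "triangle_iso T (Tri Z A Y'' \<alpha>\<^sub>1 \<beta>\<^sub>1 \<gamma>\<^sub>1) (Tri Z Z' Y'' h ?\<beta> \<gamma>\<^sub>1)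
        (ident T Z) \<beta>\<^sub>2 (ident T Y'')"
      using iso is_iso_ident b2 h objs1 compose_ident[OF hZ] ident_compose[OF maps1(2)]
        ident_compose[OF maps1(3)] compose_ident[OF maps1(3)]
      by (simp add: ident_in susp_ident)
    moreover have "candidate_triangle T (Tri Z Z' Y'' h ?\<beta> \<gamma>\<^sub>1)"
      using hZ b maps1 by simp
    ultimately have "Tri Z Z' Y'' h ?\<beta> \<gamma>\<^sub>1 \<in> exact_triangles T"
      using TR1_iso_closed D1 by blast
    moreover have "?\<beta> \<cdot>\<^bsub>T\<^esub> v' = g'"
      using compose_assoc[OF v' i(1) maps1(2)] iv oct1 unfolding octahedron.simps by simp
    moreover have "g'' \<cdot>\<^bsub>T\<^esub> \<beta>\<^sub>1 = susp_map T u \<cdot>\<^bsub>T\<^esub> w\<^sub>A"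
      using oct1 unfolding octahedron.simps by blast
    then have "g'' \<cdot>\<^bsub>T\<^esub> ?\<beta> = susp_map T u \<cdot>\<^bsub>T\<^esub> w'"
      using compose_assoc[OF i(1) maps1(2) mapsG(3)] wi
        compose_assoc[OF i(1) mapsA(3) susp_map_in[OF exact_maps(1)[OF assms(2)]]] by simp
    moreover have "\<gamma>\<^sub>1 = susp_map T v \<cdot>\<^bsub>T\<^esub> g''"
      using oct1 unfolding octahedron.simps by blast
    \<comment> \<open>The two equations on \<open>h\<close> itself, hv = v'g and w'h = w, come from
      the assumed map of triangles.\<close>
    ultimately have "octahedron T (Tri X Y Z u v w) (Tri Y Y' Y'' g g' g'')
        (Tri X Y' Z' u' v' w') h ?\<beta> \<gamma>\<^sub>1"
      using assms(2-4) G gu susp_ident[OF objs(1)]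
        ident_compose[OF exact_maps(3)[OF assms(2)]] by simp
    then show "\<exists>Y'' g' g'' \<beta> \<gamma>. Tri Y Y' Y'' g g' g'' \<in> exact_triangles T \<and>
        octahedron T (Tri X Y Z u v w) (Tri Y Y' Y'' g g' g'') (Tri X Y' Z' u' v' w') h \<beta> \<gamma>"
      using G by blast
  next
    assume "\<exists>Y'' g' g'' \<beta> \<gamma>. Tri Y Y' Y'' g g' g'' \<in> exact_triangles T \<and>
        octahedron T (Tri X Y Z u v w) (Tri Y Y' Y'' g g' g'') (Tri X Y' Z' u' v' w') h \<beta> \<gamma>"
    then obtain Y'' g' g'' \<beta> \<gamma> where G: "Tri Y Y' Y'' g g' g'' \<in> exact_triangles T"
      and oct1: "octahedron T (Tri X Y Z u v w) (Tri Y Y' Y'' g g' g'')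
        (Tri X Y' Z' (g \<cdot>\<^bsub>T\<^esub> u) v' w') h \<beta> \<gamma>"
      using gu by blast
    obtain N where N: "zero_object T N"
      using zero_object_exists by blast
    have N': "N \<in> Obj T" "susp_obj T N \<in> Obj T"
      using N susp_obj_in by (simp_all add: zero_object_def)
    \<comment> \<open>This is the required factorization
      \<open>\<beta>\<^sub>2 \<cdot> \<alpha>\<^sub>1\<close>, with \<open>\<beta>\<^sub>2\<close>
      the identity.\<close>
    have h: "h = ident T Z' \<cdot>\<^bsub>T\<^esub> h"
      using assms(4) ident_compose[of h Z Z'] by simp
    have diag: "Tri X Y' Z' (g \<cdot>\<^bsub>T\<^esub> u) v' w' \<in> exact_triangles T"
      using assms(3) gu by simp
    \<comment> \<open>\<open>N\<close> serves as the cone of the identity of \<open>X\<close>. The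
      square at \<alpha> needs v'u' = 0, which is \<open>exact_compose_zero\<close>.\<close>
    have oct2: "octahedron T (Tri X X N (ident T X) (zero_map T X N) (zero_map T N (susp_obj T X)))
        (Tri X Y' Z' u' v' w') (Tri X Y' Z' (g \<cdot>\<^bsub>T\<^esub> u) v' w')
        (zero_map T N Z') (ident T Z') (zero_map T Z' (susp_obj T N))"
      using gu assms(3) TR1_ident[OF objs(1) N] exact_from_zero_object[OF N objs(3)]
        exact_compose_zero[OF assms(3)] compose_ident[OF u'] compose_ident[OF w']
        ident_compose[OF v'] ident_compose[OF w'] objs N'
      by (simp add: compose_zero[OF zero_map_in] compose_zero[OF w'] zero_compose[OF w']
          susp_ident susp_zero_map)
    show "verdier_good T (Tri X Y Z u v w) (Tri X Y' Z' u' v' w') (ident T X) g h"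
      unfolding verdier_good.simps
      \<comment> \<open>Unification with the listed facts supplies the witnesses: \<open>N\<close>
        for the cone of the identity and \<open>Z'\<close> for \<open>A\<close>.\<close>
      by (intro conjI exI) (rule assms(4) TR1_ident[OF objs(1) N] G diag oct1 oct2 h)+
  qed
qed

end
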